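(* For each integer $r\ge 3$ and each constant $c>0$ there exist $c'>0$ and $n_0$ such that for every $n\ge n_0$, every $K_r$-free graph on $n$ vertices with average degree at least $c\, n^{1-1/r}(\log n)^{1/(r-1)}$ contains a bipartite induced subgraph of average degree at least $c'\log n$.
   Context: All graphs are finite and simple; $\log$ is the natural logarithm; $K_r$-free means containing no complete graph on $r$ vertices as a subgraph. *)

theory Defs
  imports Complex_Main "HOL-Library.Ramsey"
begin

text \<open>A graph is given by a vertex set \<open>V\<close> and a set \<open>E\<close> of edges, each edge being a
  2-element subset of \<open>V\<close>.\<close>

definition fin_simple_graph :: "'a set \<Rightarrow> 'a set set \<Rightarrow> bool" where
  "fin_simple_graph V E \<longleftrightarrow> finite V \<and> E \<subseteq> [V]\<^bsup>2\<^esup>"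

definition vertex_degree :: "'a set set \<Rightarrow> 'a \<Rightarrow> nat" where
  "vertex_degree E v = card {e \<in> E. v \<in> e}"

definition average_degree :: "'a set \<Rightarrow> 'a set set \<Rightarrow> real" where
  "average_degree V E = (\<Sum>v\<in>V. real (vertex_degree E v)) / real (card V)"

definition clique_free :: "nat \<Rightarrow> 'a set \<Rightarrow> 'a set set \<Rightarrow> bool" where
  "clique_free r V E \<longleftrightarrow> \<not> (\<exists>S \<in> [V]\<^bsup>r\<^esup>. [S]\<^bsup>2\<^esup> \<subseteq> E)"

definition induced_edges :: "'a set set \<Rightarrow> 'a set \<Rightarrow> 'a set set" where
  "induced_edges E U = {e \<in> E. e \<subseteq> U}"

definition bipartite_graph :: "'a set \<Rightarrow> 'a set set \<Rightarrow> bool" where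
  "bipartite_graph V E \<longleftrightarrow>
     (\<exists>A B. A \<union> B = V \<and> A \<inter> B = {} \<and> (\<forall>e\<in>E. \<exists>a\<in>A. \<exists>b\<in>B. e = {a, b}))"

end

theory Submission
  imports Defs "HOL-Analysis.Convex" "HOL-Real_Asymp.Real_Asymp"
begin

text \<open>By the Erdos--Szekeres bound, a graph without a clique on \<open>t + 1\<close> vertices has an
  independent set of about \<open>n powr (1 / t)\<close> vertices. Removing such sets one by one colours it
  properly with at most \<open>4 * n powr (1 - 1 / t)\<close> colours. If \<open>k\<close> colours suffice and every
  induced bipartite subgraph has average degree at most \<open>L\<close>, then summing over all pairs of colour
  classes shows that the graph has average degree at most \<open>2 * k * L\<close>. For \<open>t = r - 1\<close>, the
  assumed average degree exceeds \<open>n powr (1 - 1 / t)\<close> by a positive power of \<open>n\<close>.\<close>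

section \<open>Independent sets in graphs without large cliques\<close>

definition independent :: "'a set set \<Rightarrow> 'a set \<Rightarrow> bool" where
  "independent E I \<longleftrightarrow> (\<forall>e\<in>E. \<not> e \<subseteq> I)"

lemma independent_subset: "independent E J \<Longrightarrow> I \<subseteq> J \<Longrightarrow> independent E I"
  unfolding independent_def by blast

lemma clique_free_subset: "clique_free r V E \<Longrightarrow> W \<subseteq> V \<Longrightarrow> clique_free r W E"
  unfolding clique_free_def using nsets_mono by blast

lemma clique_free_neighbourhood:
  assumes "clique_free (Suc t) V E" "u \<in> V"
  shows "clique_free t {v \<in> V. v \<noteq> u \<and> {u, v} \<in> E} E"
  unfolding clique_free_def
proof
  assume "\<exists>S \<in> [{v \<in> V. v \<noteq> u \<and> {u, v} \<in> E}]\<^bsup>t\<^esup>. [S]\<^bsup>2\<^esup> \<subseteq> E"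
  then obtain S where S: "S \<subseteq> {v \<in> V. v \<noteq> u \<and> {u, v} \<in> E}" "finite S" "card S = t"
    and SE: "[S]\<^bsup>2\<^esup> \<subseteq> E"
    by (auto simp: nsets_def)
  have "insert u S \<in> [V]\<^bsup>Suc t\<^esup>"
    using S assms(2) by (auto simp: nsets_def card_insert_if)
  moreover have "[insert u S]\<^bsup>2\<^esup> \<subseteq> E"
  proof
    fix e assume "e \<in> [insert u S]\<^bsup>2\<^esup>"
    then obtain x y where xy: "e = {x, y}" "x \<in> insert u S" "y \<in> insert u S" "x \<noteq> y"
      by (auto elim!: nsets2_E)
    then consider "x = u" "y \<in> S" | "y = u" "x \<in> S" | "x \<in> S" "y \<in> S" by blast
    then show "e \<in> E"
    proof cases
      case 3
      then have "e \<in> [S]\<^bsup>2\<^esup>" using xy by simp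
      then show ?thesis using SE by blast
    qed (use S xy in \<open>auto simp: insert_commute\<close>)
  qed
  ultimately show False
    using assms(1) by (auto simp: clique_free_def)
qed

text \<open>Induction on \<open>t\<close> with a maximal independent set \<open>I\<close>. If
  \<open>I\<close> has fewer than \<open>s\<close> vertices, the closed neighbourhoods of its
  vertices cover \<open>V\<close>, so one of them has more than \<open>s ^ t\<close> vertices. Its
  open part has at least \<open>s ^ t\<close> vertices and contains only cliques that are one vertex
  smaller.\<close>

lemma clique_free_imp_independent_set:
  assumes "finite V" "\<forall>e\<in>E. card e = 2" "clique_free (Suc t) V E" "s ^ t \<le> card V"
  shows "\<exists>I\<subseteq>V. card I = s \<and> independent E I"
  using assms
proof (induction t arbitrary: V)
  \<comment> \<open>A single vertex is a clique of size 1, so this case is contradictory.\<close>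
  case 0
  then obtain v where "v \<in> V" by fastforce
  then have "{v} \<in> [V]\<^bsup>Suc 0\<^esup>" "[{v}]\<^bsup>2\<^esup> \<subseteq> E"
    by (simp add: nsets_def, simp add: nsets_singleton_iff)
  with 0 show ?case by (auto simp: clique_free_def)
next
  case (Suc t)
  have empty: "independent E {}"
    using Suc.prems(2) by (auto simp: independent_def)
  have "finite {I. I \<subseteq> V \<and> independent E I}"
    using Suc.prems(1) by simp
  then obtain I where I: "I \<subseteq> V" "independent E I"
    and max: "\<And>J. J \<subseteq> V \<Longrightarrow> independent E J \<Longrightarrow> I \<subseteq> J \<Longrightarrow> J = I"
    using finite_has_maximal[of "{I. I \<subseteq> V \<and> independent E I}"] empty
    by (metis (mono_tags, lifting) empty_Collect_eq empty_subsetI mem_Collect_eq)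
  have finI: "finite I" using I(1) Suc.prems(1) finite_subset by blast
  define N where "N u = {v \<in> V. v \<noteq> u \<and> {u, v} \<in> E}" for u
  have finN: "finite (N u)" for u using Suc.prems(1) by (simp add: N_def)
  show ?case
  proof (cases "s \<le> card I")
    case True
    then obtain J where "J \<subseteq> I" "card J = s" by (meson obtain_subset_with_card_n)
    then show ?thesis using I independent_subset by blast
  next
    case small: False
    have cover: "V \<subseteq> (\<Union>u\<in>I. insert u (N u))"
    proof
      fix v assume v: "v \<in> V"
      show "v \<in> (\<Union>u\<in>I. insert u (N u))"
      proof (cases "v \<in> I")
        case False
        \<comment> \<open>By maximality of \<open>I\<close>, a vertex outside \<open>I\<close> must
          have a neighbour in \<open>I\<close>.\<close>
        then have "\<not> independent E (insert v I)"
          using max[of "insert v I"] v I(1) by blast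
        then obtain e where e: "e \<in> E" "e \<subseteq> insert v I" by (auto simp: independent_def)
        moreover have "\<not> e \<subseteq> I" using I(2) e(1) by (auto simp: independent_def)
        moreover obtain x y where "e = {x, y}" "x \<noteq> y"
          using Suc.prems(2) e(1) by (meson card_2_iff)
        ultimately obtain u where "u \<in> I" "{u, v} \<in> E"
          by (auto simp: insert_commute)
        then show ?thesis using v False by (auto simp: N_def)
      qed auto
    qed
    have "\<exists>u\<in>I. s ^ t \<le> card (N u)"
    proof (rule ccontr)
      assume "\<not> ?thesis"
      \<comment> \<open>The strict bound on \<open>card (N u)\<close> leaves room for
        \<open>u\<close> itself.\<close>
      then have le: "card (insert u (N u)) \<le> s ^ t" if "u \<in> I" for u
        using that finN[of u] by (auto simp: card_insert_if not_le Suc_le_eq)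
      have "card V \<le> card (\<Union>u\<in>I. insert u (N u))"
        using cover finI finN by (intro card_mono) auto
      also have "\<dots> \<le> (\<Sum>u\<in>I. card (insert u (N u)))"
        using finI by (rule card_UN_le)
      also have "\<dots> \<le> card I * s ^ t"
        using sum_bounded_above[of I "\<lambda>u. card (insert u (N u))" "s ^ t"] le by simp
      also have "\<dots> < s * s ^ t"
        using small by (intro mult_strict_right_mono) auto
      finally show False using Suc.prems(4) by simp
    qed
    then obtain u where u: "u \<in> I" "s ^ t \<le> card (N u)" by blast
    have "clique_free (Suc t) (N u) E"
      using clique_free_neighbourhood[OF Suc.prems(3)] u(1) I(1) by (auto simp: N_def)
    then have "\<exists>J\<subseteq>N u. card J = s \<and> independent E J"
      using Suc.IH[OF finN Suc.prems(2)] u(2) by blast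
    then show ?thesis by (auto simp: N_def)
  qed
qed

section \<open>Proper colourings with few colours\<close>

text \<open>The induction step of the colour count: one new colour pays for deleting
  \<open>s\<close> vertices. With a = 1 - 1/t, concavity makes n^a drop by at least a * s * n^(a-1),
  which is at least 1/4 because a >= 1/2 and s >= n^(1-a) / 2. Hence the factor 4.\<close>

lemma powr_diff_root_le:
  fixes n s t :: nat
  assumes t: "t \<ge> 2" and s: "s \<le> n" "real n powr (1 / t) \<le> 2 * real s" and n: "n > 0"
  shows "1 + 4 * real (n - s) powr (1 - 1 / t) \<le> 4 * real n powr (1 - 1 / t)"
\<comment> \<open>Young's inequality is applied below to a positive \<open>n - s\<close>; for
  \<open>n = s\<close> the power on the left is 0.\<close>
proof (cases "n = s")
  case True
  have "1 \<le> real n powr (1 - 1 / t)"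
    using n t by (intro ge_one_powr_ge_zero) auto
  then show ?thesis using True by simp
next
  case False
  define a where "a = 1 - 1 / real t"
  define p where "p = real n powr (1 / t)"
  have a: "a \<ge> 1 / 2" "a \<le> 1" using t by (auto simp: a_def field_simps)
  have p: "p > 0" "p \<le> 2 * s" using n s by (auto simp: p_def)
  have np: "real n = real n powr a * p"
    using n by (simp add: a_def p_def flip: powr_add)
  \<comment> \<open>Weighted AM-GM for \<open>n - s\<close> and \<open>n\<close> with weights
    \<open>a\<close> and \<open>1 / t\<close>. It is the tangent line bound at \<open>n\<close>,
    multiplied by \<open>p\<close> to avoid negative exponents.\<close>
  have "real (n - s) powr a * p \<le> a * real (n - s) + (1 / t) * real n"
    unfolding p_def using False s n t a
    by (intro Youngs_inequality_0) (auto simp: a_def)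
  also have "\<dots> = real n - a * s"
    using s(1) by (simp add: a_def of_nat_diff algebra_simps)
  also have "\<dots> \<le> real n - p / 4"
    using mult_right_mono[OF a(1), of "real s"] p(2) by linarith
  finally have "(real (n - s) powr a + 1 / 4) * p \<le> real n powr a * p"
    using np by (simp add: algebra_simps)
  then have "real (n - s) powr a + 1 / 4 \<le> real n powr a"
    using p(1) by simp
  then show ?thesis by (simp add: a_def)
qed

text \<open>Greedy colouring: an independent set of size about n^(1/t) receives a fresh colour, and
  the remaining vertices are coloured by induction.\<close>

lemma clique_free_imp_colouring:
  assumes "finite V" "\<forall>e\<in>E. card e = 2" "clique_free (Suc t) V E" "t \<ge> 2"
  shows "\<exists>k (f :: 'a \<Rightarrow> nat). f ` V \<subseteq> {..<k} \<and> (\<forall>i. independent E {v \<in> V. f v = i})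
           \<and> real k \<le> 4 * real (card V) powr (1 - 1 / t)"
  using assms
proof (induction "card V" arbitrary: V rule: less_induct)
  case less
  show ?case
  proof (cases "V = {}")
    case True
    have "\<And>e. e \<in> E \<Longrightarrow> e \<noteq> {}" using less.prems(2) by fastforce
    then show ?thesis using True
      by (intro exI[of _ 0]) (auto simp: independent_def)
  next
    case False
    define n where "n = card V"
    have n: "n > 0" using False less.prems(1) by (simp add: n_def card_gt_0_iff)
    define x where "x = real n powr (1 / t)"
    define s where "s = nat \<lfloor>x\<rfloor>"
    have x1: "x \<ge> 1"
      unfolding x_def using n by (intro ge_one_powr_ge_zero) auto
    have "real s = of_int \<lfloor>x\<rfloor>" "\<lfloor>x\<rfloor> \<ge> 1" using x1 by (simp_all add: s_def)
    \<comment> \<open>Rounding down a number that is at least 1 loses at most a factor of 2.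
      Positivity of \<open>s\<close> makes the remaining vertex set smaller.\<close>
    then have sx: "real s \<le> x" "x \<le> 2 * real s" "s > 0"
      by linarith+
    have "real (s ^ t) \<le> x ^ t"
      using sx by (simp add: power_mono)
    also have "x ^ t = real n"
      unfolding x_def using n less.prems(4) by (simp add: powr_power)
    finally have "s ^ t \<le> card V" by (simp add: n_def)
    then obtain I where I: "I \<subseteq> V" "card I = s" "independent E I"
      using clique_free_imp_independent_set less.prems by metis
    have finI: "finite I" using I(1) less.prems(1) finite_subset by blast
    have s_le: "s \<le> n" unfolding n_def using I less.prems(1) card_mono by blast
    have card: "card (V - I) = n - s"
      using I finI by (simp add: card_Diff_subset n_def)
    obtain k and f :: "'a \<Rightarrow> nat" where f: "f ` (V - I) \<subseteq> {..<k}"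
        "\<And>i. independent E {v \<in> V - I. f v = i}"
        "real k \<le> 4 * real (n - s) powr (1 - 1 / t)"
      using less.hyps[of "V - I"] less.prems clique_free_subset[of _ V E "V - I"] card sx(3) n
      by (auto simp: n_def)
    define g where "g v = (if v \<in> I then k else f v)" for v
    have "g ` V \<subseteq> {..<Suc k}" using f(1) by (auto simp: g_def less_Suc_eq)
    moreover have "independent E {v \<in> V. g v = i}" for i
    proof (cases "i = k")
      case True
      then have "{v \<in> V. g v = i} \<subseteq> I" using f(1) by (auto simp: g_def)
      then show ?thesis using I(3) independent_subset by blast
    next
      case False
      then have "{v \<in> V. g v = i} \<subseteq> {v \<in> V - I. f v = i}" by (auto simp: g_def)
      then show ?thesis using f(2) independent_subset by blast
    qed
    moreover have "real (Suc k) \<le> 4 * real n powr (1 - 1 / t)"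
      using powr_diff_root_le[OF less.prems(4) s_le _ n] sx(2) f(3) by (simp add: x_def)
    ultimately show ?thesis unfolding n_def by blast
  qed
qed

section \<open>Averaging over pairs of colour classes\<close>

lemma average_degree_handshake:
  assumes "finite V" "E \<subseteq> [V]\<^bsup>2\<^esup>"
  shows "average_degree V E * card V = 2 * card E"
proof -
  have finE: "finite E"
    using assms finite_imp_finite_nsets finite_subset by blast
  have "(\<Sum>v\<in>V. vertex_degree E v) = 2 * card E"
    unfolding vertex_degree_def
  proof (rule sum_multicount)
    show "\<forall>e\<in>E. card {v \<in> V. v \<in> e} = 2"
    proof
      fix e assume "e \<in> E"
      then have "e \<subseteq> V" "card e = 2" using assms(2) by (auto simp: nsets_def)
      moreover from this have "{v \<in> V. v \<in> e} = e" by blast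
      ultimately show "card {v \<in> V. v \<in> e} = 2" by simp
    qed
  qed (use assms finE in auto)
  then have "(\<Sum>v\<in>V. real (vertex_degree E v)) = 2 * card E"
    by (metis of_nat_mult of_nat_numeral of_nat_sum)
  \<comment> \<open>For empty \<open>V\<close> the quotient in \<open>average_degree\<close> is 0 by
    convention, so \<open>E\<close> must be seen to be empty.\<close>
  moreover have "E = {}" if "card V = 0"
    using that assms by (auto simp: nsets_def)
  ultimately show ?thesis by (auto simp: average_degree_def)
qed

lemma bipartite_graph_union_independent:
  assumes "\<forall>e\<in>E. card e = 2" "independent E A" "independent E B"
  shows "bipartite_graph (A \<union> B) (induced_edges E (A \<union> B))"
  unfolding bipartite_graph_def
\<comment> \<open>\<open>A\<close> and \<open>B\<close> may overlap, so the second side is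
  \<open>B - A\<close>. An edge inside neither set has one end in \<open>A - B\<close> and the other
  in \<open>B - A\<close>.\<close>
proof (rule exI[of _ A], rule exI[of _ "B - A"], intro conjI ballI)
  fix e assume "e \<in> induced_edges E (A \<union> B)"
  then have e: "e \<in> E" "e \<subseteq> A \<union> B" by (auto simp: induced_edges_def)
  moreover obtain x y where "e = {x, y}" "x \<noteq> y"
    using assms(1) e(1) by (meson card_2_iff)
  moreover have "\<not> e \<subseteq> A" "\<not> e \<subseteq> B" using assms(2,3) e(1) by (auto simp: independent_def)
  ultimately show "\<exists>a\<in>A. \<exists>b\<in>B - A. e = {a, b}"
    by (auto simp: insert_commute)
qed auto

text \<open>Every edge lies in the subgraph induced by the two colour classes of its ends. Summing
  the handshake bounds over all ordered pairs of colours, diagonal included, counts each vertex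
  \<open>2 * k\<close> times.\<close>

lemma average_degree_le_colours:
  fixes f :: "'a \<Rightarrow> nat"
  assumes G: "finite V" "E \<subseteq> [V]\<^bsup>2\<^esup>" "V \<noteq> {}"
    and f: "f ` V \<subseteq> {..<k}" "\<And>i. independent E {v \<in> V. f v = i}"
    and L: "\<And>U. U \<subseteq> V \<Longrightarrow> U \<noteq> {} \<Longrightarrow> bipartite_graph U (induced_edges E U)
              \<Longrightarrow> average_degree U (induced_edges E U) \<le> L"
  shows "average_degree V E \<le> 2 * real k * L"
proof -
  define A where "A i = {v \<in> V. f v = i}" for i
  define U where "U p = A (fst p) \<union> A (snd p)" for p
  let ?P = "{..<k} \<times> {..<k}"
  have two: "\<forall>e\<in>E. card e = 2" using G(2) by (auto simp: nsets_def)
  have finE: "finite E" using G finite_imp_finite_nsets finite_subset by blast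
  have finA: "finite (A i)" for i using G(1) by (simp add: A_def)
  have U_sub: "U p \<subseteq> V" for p by (auto simp: U_def A_def)
  have sumA: "(\<Sum>i<k. card (A i)) = card V"
    unfolding A_def using G(1) f(1) sum.group[of V "{..<k}" f "\<lambda>_. 1::nat"] by simp
  have pair: "2 * real (card (induced_edges E (U p))) \<le> L * (card (A (fst p)) + card (A (snd p)))"
    if p: "p \<in> ?P" for p
  proof -
    have finU: "finite (U p)" using finA by (simp add: U_def)
    have "induced_edges E (U p) \<subseteq> [U p]\<^bsup>2\<^esup>"
      using two finU finite_subset by (auto simp: induced_edges_def nsets_def)
    then have eq: "2 * real (card (induced_edges E (U p)))
        = average_degree (U p) (induced_edges E (U p)) * card (U p)"
      using average_degree_handshake[OF finU] by simp
    show ?thesis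
    proof (cases "U p = {}")
      case True
      then show ?thesis using eq by (simp add: U_def)
    next
      case False
      have "bipartite_graph (U p) (induced_edges E (U p))"
        unfolding U_def by (rule bipartite_graph_union_independent[OF two]) (simp_all add: A_def f(2))
      then have "average_degree (U p) (induced_edges E (U p)) \<le> L"
        using L U_sub False by blast
      \<comment> \<open>This makes \<open>L\<close> nonnegative, as the product bound
        requires.\<close>
      moreover have "average_degree (U p) (induced_edges E (U p)) \<ge> 0"
        by (simp add: average_degree_def sum_nonneg)
      moreover have "card (U p) \<le> card (A (fst p)) + card (A (snd p))"
        unfolding U_def by (rule card_Un_le)
      ultimately show ?thesis unfolding eq
        by (intro mult_mono) (auto simp flip: of_nat_add)
    qed
  qed
  have "E \<subseteq> (\<Union>p\<in>?P. induced_edges E (U p))"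
  proof
    fix e assume e: "e \<in> E"
    then obtain x y where xy: "e = {x, y}" "x \<in> V" "y \<in> V"
      using G(2) by (blast elim: nsets2_E)
    then have "(f x, f y) \<in> ?P" using f(1) by auto
    moreover have "e \<in> induced_edges E (U (f x, f y))"
      using e xy by (auto simp: induced_edges_def U_def A_def)
    ultimately show "e \<in> (\<Union>p\<in>?P. induced_edges E (U p))" by blast
  qed
  then have "card E \<le> card (\<Union>p\<in>?P. induced_edges E (U p))"
    using finE by (intro card_mono) (auto simp: induced_edges_def)
  also have "\<dots> \<le> (\<Sum>p\<in>?P. card (induced_edges E (U p)))"
    by (intro card_UN_le) auto
  finally have "2 * real (card E) \<le> (\<Sum>p\<in>?P. 2 * real (card (induced_edges E (U p))))"
    by (simp flip: sum_distrib_left of_nat_sum)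
  also have "\<dots> \<le> (\<Sum>p\<in>?P. L * (card (A (fst p)) + card (A (snd p))))"
    using pair by (intro sum_mono) auto
  also have "\<dots> = L * real (\<Sum>i<k. \<Sum>j<k. card (A i) + card (A j))"
    by (simp add: sum.cartesian_product case_prod_beta sum_distrib_left)
  also have "(\<Sum>i<k. \<Sum>j<k. card (A i) + card (A j)) = 2 * k * card V"
    by (simp add: sum.distrib sumA flip: sum_distrib_left)
  finally have "average_degree V E * card V \<le> (2 * real k * L) * card V"
    using average_degree_handshake[OF G(1,2)] by (simp add: algebra_simps)
  moreover have "card V > 0" using G by (simp add: card_gt_0_iff)
  ultimately show ?thesis by simp
qed

theorem theorem3p11:
  fixes r :: nat and c :: real
  assumes "r \<ge> 3" and "c > 0"
  shows "\<exists>c'::real. c' > 0 \<and> (\<exists>n0::nat. \<forall>n\<ge>n0. \<forall>(V :: 'a set) E.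
           fin_simple_graph V E \<and> card V = n \<and> clique_free r V E \<and>
           average_degree V E
             \<ge> c * real n powr (1 - 1 / real r) * ln (real n) powr (1 / (real r - 1))
           \<longrightarrow> (\<exists>U. U \<subseteq> V \<and> U \<noteq> {} \<and> bipartite_graph U (induced_edges E U) \<and>
                  average_degree U (induced_edges E U) \<ge> c' * ln (real n)))"
proof -
  define t where "t = r - 1"
  have t: "t \<ge> 2" "r = Suc t" "real r - 1 = real t" using assms(1) by (auto simp: t_def)
  \<comment> \<open>The gap between the exponent 1 - 1/r of the assumed degree and the exponent 1 -
    1/t of the colour count.\<close>
  define \<delta> where "\<delta> = 1 / real t - 1 / real r"
  have \<delta>: "\<delta> > 0" using t(1,2) by (simp add: \<delta>_def frac_less2)
  \<comment> \<open>The 8 combines the 4 of the colour count with the 2 of the averaging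
    bound.\<close>
  have "eventually (\<lambda>n. 8 * ln (real n) < c * real n powr \<delta> \<and> ln (real n) \<ge> 1) sequentially"
    using \<open>c > 0\<close> \<delta> by (intro eventually_conj; real_asymp)
  then obtain n0 where n0: "\<And>n. n \<ge> n0 \<Longrightarrow> 8 * ln (real n) < c * real n powr \<delta>"
      "\<And>n. n \<ge> n0 \<Longrightarrow> ln (real n) \<ge> 1"
    by (auto simp: eventually_sequentially)
  have main: "\<exists>U\<subseteq>V. U \<noteq> {} \<and> bipartite_graph U (induced_edges E U) \<and>
      average_degree U (induced_edges E U) \<ge> ln (real n)"
    if n: "n \<ge> n0" and G: "fin_simple_graph V E" "card V = n" "clique_free r V E"
      and d: "average_degree V E
             \<ge> c * real n powr (1 - 1 / real r) * ln (real n) powr (1 / (real r - 1))"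
    for n and V :: "'a set" and E
  proof (rule ccontr)
    assume contra: "\<not> ?thesis"
    have ln1: "ln (real n) \<ge> 1" using n0(2) n .
    \<comment> \<open>In HOL \<open>ln 0 = 0\<close>, so the lower bound on the logarithm excludes
      \<open>n = 0\<close>.\<close>
    then have npos: "n > 0" by (cases n) auto
    have fin: "finite V" "E \<subseteq> [V]\<^bsup>2\<^esup>" using G(1) by (auto simp: fin_simple_graph_def)
    then have two: "\<forall>e\<in>E. card e = 2" by (auto simp: nsets_def)
    obtain k and f :: "'a \<Rightarrow> nat" where f: "f ` V \<subseteq> {..<k}"
        "\<And>i. independent E {v \<in> V. f v = i}" "real k \<le> 4 * real n powr (1 - 1 / t)"
      using clique_free_imp_colouring[OF fin(1) two] G t by blast
    \<comment> \<open>By \<open>contra\<close>, \<open>ln (real n)\<close> can serve as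
      \<open>L\<close> in the averaging bound.\<close>
    have "average_degree V E \<le> 2 * real k * ln (real n)"
      using contra npos G(2) by (intro average_degree_le_colours[OF fin _ f(1,2)]) force+
    also have "\<dots> \<le> 2 * (4 * real n powr (1 - 1 / t)) * ln (real n)"
      using f(3) ln1 by (intro mult_right_mono mult_left_mono) auto
    also have "\<dots> = real n powr (1 - 1 / t) * (8 * ln (real n))" by simp
    also have "\<dots> < real n powr (1 - 1 / t) * (c * real n powr \<delta>)"
      using n0(1)[OF n] npos by (intro mult_strict_left_mono) auto
    also have "\<dots> = c * real n powr (1 - 1 / r)"
      by (simp add: \<delta>_def flip: powr_add)
    also have "\<dots> \<le> c * real n powr (1 - 1 / r) * ln (real n) powr (1 / (real r - 1))"
    proof -
      have "1 \<le> ln (real n) powr (1 / (real r - 1))"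
        using ln1 t by (intro ge_one_powr_ge_zero) auto
      then show ?thesis using \<open>c > 0\<close> mult_left_mono[of 1 _ "c * real n powr (1 - 1 / r)"] by simp
    qed
    finally show False using d by simp
  qed
  show ?thesis
    \<comment> \<open>The constant \<open>c'\<close> can be 1 for every \<open>c\<close>, since
      \<open>c\<close> only influences \<open>n0\<close>.\<close>
    using main by (intro exI[of _ 1] conjI exI[of _ n0]) (auto simp del: of_nat_Suc)
qed

end
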